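(* For $n\geq 2$, \[ d_n^B(q)=(2n-1)q\,d_{n-1}^B(q)+2q(1-q)\,\frac{d}{dq}d_{n-1}^{B}(q)+2(n-1)q\,d_{n-2}^B(q). \]
   Context: Let $B_n$ be the set of signed permutations $\sigma=\sigma_1\cdots\sigma_n$ of $[n]=\{1,\dots,n\}$ (permutations of $[n]$ in which some entries carry a minus sign). An index $i\in[n]$ is a type $B$ excedance of $\sigma$ if either $\sigma_i=-i$ or $\sigma_{|\sigma_i|}>\sigma_i$; $\mathrm{exc}_B(\sigma)$ denotes the number of type $B$ excedances. A type $B$ derangement is $\sigma\in B_n$ with $\sigma_i\neq i$ for all $i\in[n]$ (entries $\sigma_i=-i$ are allowed); $D_n^B$ is the set of these. Define $d_n^B(q)=\sum_{\sigma\in D_n^B}q^{\mathrm{exc}_B(\sigma)}$ for $n\geq1$ and $d_0^B(q)=1$. *)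

theory Defs
  imports Main "HOL-Library.FuncSet" "HOL-Computational_Algebra.Polynomial"
begin

text \<open>
  A signed permutation is its word \<open>\<sigma> 1, \<dots>, \<sigma> n\<close>, as a function on \<open>{1..n}\<close> whose
  absolute values permute \<open>{1..n}\<close>. Extensionality (\<open>\<rightarrow>\<^sub>E\<close>) makes \<open>\<sigma>\<close> determined by its word.
\<close>

definition signed_perms :: "nat \<Rightarrow> (nat \<Rightarrow> int) set" where
  "signed_perms n =
     {\<sigma> \<in> {1..n} \<rightarrow>\<^sub>E UNIV. bij_betw (\<lambda>i. nat \<bar>\<sigma> i\<bar>) {1..n} {1..n}}"

definition excB :: "nat \<Rightarrow> (nat \<Rightarrow> int) \<Rightarrow> nat" where
  "excB n \<sigma> = card {i \<in> {1..n}. \<sigma> i = - int i \<or> \<sigma> (nat \<bar>\<sigma> i\<bar>) > \<sigma> i}"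

definition derangementsB :: "nat \<Rightarrow> (nat \<Rightarrow> int) set" where
  "derangementsB n = {\<sigma> \<in> signed_perms n. \<forall>i \<in> {1..n}. \<sigma> i \<noteq> int i}"

definition dB :: "nat \<Rightarrow> int poly" where
  "dB n = (if n = 0 then 1 else (\<Sum>\<sigma> \<in> derangementsB n. monom 1 (excB n \<sigma>)))"

end

theory Submission
  imports Defs
begin

text \<open>
  Write \<open>\<sigma>\<close> as a product of cycles of signed values \<open>a \<mapsto> \<sigma> \<bar>a\<bar>\<close>. Then \<open>exc\<^sub>B\<close> counts the cyclic
  ascents, where a negative one-cycle counts as an ascent. Inserting \<open>m\<close> or \<open>-m\<close>, with \<open>m\<close>
  larger than all letters present, between \<open>a\<close> and its successor replaces the pair by one ascent and
  one descent, so the statistic stays the same if \<open>a\<close> was an ascent and grows by one otherwise.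
  A derangement with \<open>m\<close> as largest letter arises uniquely in one of three ways: by adding the
  one-cycle \<open>-m\<close> to a derangement, by such an insertion into a derangement, or by such an insertion
  into the only positive one-cycle \<open>k\<close> of a signed permutation. For arbitrary finite sets of positive
  letters this gives a recurrence, and by induction the generating function depends only on the
  number of letters, so that no relabelling is needed after \<open>k\<close> is removed.
\<close>

section \<open>Signed permutations of a finite set of letters, and the transfer from
  \<open>{1..n}\<close>\<close>

definition signed_perms_on :: "nat set \<Rightarrow> (nat \<Rightarrow> int) set" where
  "signed_perms_on A = {\<sigma> \<in> A \<rightarrow>\<^sub>E UNIV. bij_betw (\<lambda>i. nat \<bar>\<sigma> i\<bar>) A A}"

definition derangements_on :: "nat set \<Rightarrow> (nat \<Rightarrow> int) set" where
  "derangements_on A = {\<sigma> \<in> signed_perms_on A. \<forall>i\<in>A. \<sigma> i \<noteq> int i}"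

text \<open>Excedances are recorded by the value \<open>a = \<sigma> i\<close> instead of the index \<open>i\<close>.\<close>

definition exc_values :: "nat set \<Rightarrow> (nat \<Rightarrow> int) \<Rightarrow> int set" where
  "exc_values A \<sigma> = {a \<in> \<sigma> ` A. a < \<sigma> (nat \<bar>a\<bar>) \<or> (\<sigma> (nat \<bar>a\<bar>) = a \<and> a < 0)}"

definition derangement_poly :: "nat set \<Rightarrow> int poly" where
  "derangement_poly A = (\<Sum>\<sigma>\<in>derangements_on A. monom 1 (card (exc_values A \<sigma>)))"

text \<open>An injective self-map of a finite set is onto, so surjectivity never has to be checked
  by hand.\<close>

lemma signed_perms_onI:
  assumes "finite A"
    and "\<And>i. i \<notin> A \<Longrightarrow> \<sigma> i = undefined"
    and "\<And>i. i \<in> A \<Longrightarrow> nat \<bar>\<sigma> i\<bar> \<in> A"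
    and "\<And>i j. i \<in> A \<Longrightarrow> j \<in> A \<Longrightarrow> \<bar>\<sigma> i\<bar> = \<bar>\<sigma> j\<bar> \<Longrightarrow> i = j"
  shows "\<sigma> \<in> signed_perms_on A"
proof -
  have "inj_on (\<lambda>i. nat \<bar>\<sigma> i\<bar>) A"
    using assms(4) by (auto simp: inj_on_def)
  moreover from this have "(\<lambda>i. nat \<bar>\<sigma> i\<bar>) ` A = A"
    using assms(1,3) by (intro endo_inj_surj) auto
  ultimately show ?thesis
    using assms(2) by (auto simp: signed_perms_on_def bij_betw_def)
qed

lemma signed_perms_on_undefined:
  assumes "\<sigma> \<in> signed_perms_on A" "i \<notin> A"
  shows "\<sigma> i = undefined"
  using assms by (auto simp: signed_perms_on_def PiE_iff extensional_def)

lemma signed_perms_on_surj: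
  assumes "\<sigma> \<in> signed_perms_on A" "k \<in> A"
  obtains i where "i \<in> A" "nat \<bar>\<sigma> i\<bar> = k"
proof -
  have "k \<in> (\<lambda>i. nat \<bar>\<sigma> i\<bar>) ` A"
    using assms by (simp add: signed_perms_on_def bij_betw_def)
  then show thesis using that by blast
qed

lemma signed_perms_on_inj:
  assumes "\<sigma> \<in> signed_perms_on A" "i \<in> A" "j \<in> A" "\<bar>\<sigma> i\<bar> = \<bar>\<sigma> j\<bar>"
  shows "i = j"
  using assms by (auto simp: signed_perms_on_def bij_betw_def inj_on_def)

lemma signed_perms_on_abs_mem:
  assumes "\<sigma> \<in> signed_perms_on A" "i \<in> A"
  shows "nat \<bar>\<sigma> i\<bar> \<in> A"
  using assms by (auto simp: signed_perms_on_def bij_betw_def)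

text \<open>Used to reindex a sum over insertion positions by the value \<open>a\<close> after which
  the letter is inserted.\<close>

lemma bij_betw_abs_values:
  assumes "\<sigma> \<in> signed_perms_on A"
  shows "bij_betw (\<lambda>a. nat \<bar>a\<bar>) (\<sigma> ` A) A"
  using assms by (auto simp: signed_perms_on_def bij_betw_def inj_on_def image_image)

lemma finite_signed_perms_on:
  assumes "finite A"
  shows "finite (signed_perms_on A)"
proof -
  have "finite (A \<rightarrow>\<^sub>E (int ` A \<union> uminus ` int ` A))"
    using assms by (intro finite_PiE) auto
  moreover have "signed_perms_on A \<subseteq> A \<rightarrow>\<^sub>E (int ` A \<union> uminus ` int ` A)"
  proof
    fix \<sigma> assume s: "\<sigma> \<in> signed_perms_on A"
    have "\<sigma> i \<in> int ` A \<union> uminus ` int ` A" if "i \<in> A" for i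
    proof (cases "\<sigma> i \<ge> 0")
      case True
      then have "\<sigma> i = int (nat \<bar>\<sigma> i\<bar>)" by simp
      then show ?thesis using signed_perms_on_abs_mem[OF s that] by blast
    next
      case False
      then have "\<sigma> i = - int (nat \<bar>\<sigma> i\<bar>)" by simp
      then show ?thesis using signed_perms_on_abs_mem[OF s that] by blast
    qed
    then show "\<sigma> \<in> A \<rightarrow>\<^sub>E (int ` A \<union> uminus ` int ` A)"
      using s by (auto simp: signed_perms_on_def PiE_iff)
  qed
  ultimately show ?thesis by (rule rev_finite_subset)
qed

lemma finite_derangements_on: "finite A \<Longrightarrow> finite (derangements_on A)"
  by (simp add: derangements_on_def finite_signed_perms_on)

lemma finite_exc_values: "finite A \<Longrightarrow> finite (exc_values A \<sigma>)"
  by (simp add: exc_values_def)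

lemma card_exc_values_le:
  assumes "\<sigma> \<in> signed_perms_on A" "finite A"
  shows "card (exc_values A \<sigma>) \<le> card A"
proof -
  have "card (exc_values A \<sigma>) \<le> card (\<sigma> ` A)"
    using assms(2) by (intro card_mono) (auto simp: exc_values_def)
  also have "\<dots> \<le> card A"
    using assms(2) by (rule card_image_le)
  finally show ?thesis .
qed

lemma signed_perms_eq: "signed_perms n = signed_perms_on {1..n}"
  by (simp add: signed_perms_def signed_perms_on_def)

lemma derangementsB_eq: "derangementsB n = derangements_on {1..n}"
  by (simp add: derangementsB_def derangements_on_def signed_perms_eq)

lemma excB_eq:
  assumes s: "\<sigma> \<in> signed_perms n"
  shows "excB n \<sigma> = card (exc_values {1..n} \<sigma>)"
proof -
  let ?I = "{i \<in> {1..n}. \<sigma> i = - int i \<or> \<sigma> (nat \<bar>\<sigma> i\<bar>) > \<sigma> i}"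
  note s' = s[unfolded signed_perms_eq]
  have "exc_values {1..n} \<sigma> = \<sigma> ` ?I"
  proof (intro equalityI subsetI)
    fix a assume "a \<in> exc_values {1..n} \<sigma>"
    then obtain i where i: "i \<in> {1..n}" "a = \<sigma> i"
      and a: "a < \<sigma> (nat \<bar>a\<bar>) \<or> (\<sigma> (nat \<bar>a\<bar>) = a \<and> a < 0)"
      by (auto simp: exc_values_def)
    \<comment> \<open>A value that is its own successor is a one-cycle: it is taken at both
      \<open>nat \<bar>a\<bar>\<close> and \<open>i\<close>, so these positions agree, and
      \<open>a < 0\<close> fixes the sign.\<close>
    have "\<sigma> i = - int i" if "\<sigma> (nat \<bar>a\<bar>) = a" "a < 0"
      using signed_perms_on_inj[OF s' signed_perms_on_abs_mem[OF s' i(1)] i(1)] that i(2) by auto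
    then show "a \<in> \<sigma> ` ?I" using i a by auto
  next
    fix a assume "a \<in> \<sigma> ` ?I"
    then show "a \<in> exc_values {1..n} \<sigma>" by (auto simp: exc_values_def)
  qed
  moreover have "inj_on \<sigma> ?I"
    using signed_perms_on_inj[OF s'] by (auto simp: inj_on_def)
  ultimately show ?thesis by (simp add: excB_def card_image)
qed

lemma derangement_poly_empty [simp]: "derangement_poly {} = 1"
proof -
  have "derangements_on {} = {\<lambda>_. undefined}"
    by (auto simp: derangements_on_def signed_perms_on_def bij_betw_def)
  then show ?thesis by (simp add: derangement_poly_def exc_values_def one_poly_eq_simps)
qed

lemma dB_eq: "dB n = derangement_poly {1..n}"
proof (cases "n = 0")
  case False
  have "excB n \<sigma> = card (exc_values {1..n} \<sigma>)" if "\<sigma> \<in> derangements_on {1..n}" for \<sigma>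
    using that by (intro excB_eq) (simp add: derangements_on_def signed_perms_eq)
  with False show ?thesis
    by (simp add: dB_def derangement_poly_def derangementsB_eq)
qed (simp add: dB_def)

subsection \<open>Insertion of the largest letter\<close>

text \<open>If \<open>a\<close> is the value with \<open>nat \<bar>a\<bar> = i\<close>, its
  successor was \<open>\<tau> i\<close>; now the cycle runs through \<open>a\<close>,
  \<open>s\<close>, \<open>\<tau> i\<close>. The intended \<open>s\<close> is \<open>int m\<close>
  or \<open>- int m\<close>, so that position \<open>m\<close> holds the successor of
  \<open>s\<close>.\<close>

definition insert_letter :: "nat \<Rightarrow> int \<Rightarrow> nat \<Rightarrow> (nat \<Rightarrow> int) \<Rightarrow> nat \<Rightarrow> int" where
  "insert_letter m s i \<tau> = \<tau>(i := s, m := \<tau> i)"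

lemma insert_letter_signed_perms_on:
  assumes "finite B" "m \<notin> B" "i \<in> B" "\<bar>s\<bar> = int m" "\<tau> \<in> signed_perms_on B"
  shows "insert_letter m s i \<tau> \<in> signed_perms_on (insert m B)"
proof -
  have fin: "finite (insert m B)" using assms(1) by simp
  have ne: "\<bar>\<tau> j\<bar> \<noteq> int m" if "j \<in> B" for j
    using signed_perms_on_abs_mem[OF assms(5) that] assms(2) by auto
  show ?thesis
  proof (rule signed_perms_onI[OF fin])
    fix j assume "j \<notin> insert m B"
    then show "insert_letter m s i \<tau> j = undefined"
      using assms(3) signed_perms_on_undefined[OF assms(5)] by (auto simp: insert_letter_def)
  next
    fix j assume "j \<in> insert m B"
    then show "nat \<bar>insert_letter m s i \<tau> j\<bar> \<in> insert m B"
      using assms(3,4) signed_perms_on_abs_mem[OF assms(5)] by (auto simp: insert_letter_def)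
  next
    fix j k assume "j \<in> insert m B" "k \<in> insert m B"
      "\<bar>insert_letter m s i \<tau> j\<bar> = \<bar>insert_letter m s i \<tau> k\<bar>"
    then show "j = k"
      using assms(2-4) ne ne[symmetric] signed_perms_on_inj[OF assms(5)]
      by (auto simp: insert_letter_def split: if_splits)
  qed
qed

lemma remove_letter_signed_perms_on:
  assumes "finite B" "m \<notin> B" "i \<in> B" "\<bar>\<sigma> i\<bar> = int m" "\<sigma> \<in> signed_perms_on (insert m B)"
  shows "\<sigma>(i := \<sigma> m, m := undefined) \<in> signed_perms_on B"
proof -
  have fin: "finite (insert m B)" using assms(1) by simp
  have ne: "\<bar>\<sigma> j\<bar> \<noteq> int m" if "j \<in> insert m B" "j \<noteq> i" for j
    using signed_perms_on_inj[OF assms(5) that(1), of i] that assms(3,4) by auto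
  have mem: "nat \<bar>\<sigma> j\<bar> \<in> B" if "j \<in> insert m B" "j \<noteq> i" for j
    using signed_perms_on_abs_mem[OF assms(5) that(1)] ne[OF that] by auto
  let ?\<tau> = "\<sigma>(i := \<sigma> m, m := undefined)"
  show ?thesis
  proof (rule signed_perms_onI[OF assms(1)])
    fix j assume "j \<notin> B"
    then show "?\<tau> j = undefined"
      using assms(3) signed_perms_on_undefined[OF assms(5)] by auto
  next
    fix j assume "j \<in> B"
    then show "nat \<bar>?\<tau> j\<bar> \<in> B"
      using assms(2,3) mem[of j] mem[of m] by auto
  next
    fix j k assume h: "j \<in> B" "k \<in> B" "\<bar>?\<tau> j\<bar> = \<bar>?\<tau> k\<bar>"
    \<comment> \<open>\<open>f\<close> gives the position of \<open>\<sigma>\<close> from which the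
      shortened word reads its value; only \<open>i\<close> borrows from elsewhere, namely from
      \<open>m\<close>. Injectivity then comes from that of \<open>\<sigma>\<close>.\<close>
    define f where "f l = (if l = i then m else l)" for l
    have "i \<noteq> m" "j \<noteq> m" "k \<noteq> m" using h assms(2,3) by auto
    then have "\<bar>\<sigma> (f j)\<bar> = \<bar>\<sigma> (f k)\<bar>"
      using h(3) by (simp add: f_def split: if_splits)
    then have "f j = f k"
      using h by (intro signed_perms_on_inj[OF assms(5)]) (auto simp: f_def)
    then show "j = k" using h assms(2) by (auto simp: f_def split: if_splits)
  qed
qed

text \<open>As \<open>\<bar>s\<bar>\<close> exceeds the absolute value of every value of
  \<open>\<tau>\<close>, exactly one of the steps from \<open>a\<close> to \<open>s\<close> and from
  \<open>s\<close> to \<open>\<tau> i\<close> is an ascent. All other values keep their successors,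
  while the former status of \<open>a\<close> is lost; hence the \<open>Suc\<close> and the removal
  of \<open>a\<close>.\<close>

lemma exc_values_insert_letter:
  assumes "finite B" "\<forall>b\<in>B. b < m" "\<bar>s\<bar> = int m" "\<tau> \<in> signed_perms_on B"
    and a: "a \<in> \<tau> ` B" "nat \<bar>a\<bar> = i"
  shows "card (exc_values (insert m B) (insert_letter m s i \<tau>)) =
    Suc (card (exc_values B \<tau> - {a}))"
proof -
  let ?\<sigma> = "insert_letter m s i \<tau>"
  have mB: "m \<notin> B" using assms(2) by auto
  have small: "nat \<bar>b\<bar> \<in> B" "\<bar>b\<bar> < int m" if "b \<in> \<tau> ` B" for b
    using signed_perms_on_abs_mem[OF assms(4)] assms(2) that by fastforce+
  have i: "i \<in> B" using small[OF a(1)] a(2) by simp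
  have \<tau>i: "\<bar>\<tau> i\<bar> < int m" using small i by blast
  have im: "i \<noteq> m" using i mB by auto
  have img: "?\<sigma> ` insert m B = insert s (\<tau> ` B)"
    using i mB by (auto simp: insert_letter_def image_iff)
  have other: "?\<sigma> (nat \<bar>b\<bar>) = \<tau> (nat \<bar>b\<bar>)" if "b \<in> \<tau> ` B" "b \<noteq> a" for b
  proof -
    have "nat \<bar>b\<bar> \<noteq> i"
      using bij_betw_abs_values[OF assms(4)] that a
      by (auto simp: bij_betw_def inj_on_def)
    moreover have "nat \<bar>b\<bar> \<noteq> m" using small[OF that(1)] mB by auto
    ultimately show ?thesis by (simp add: insert_letter_def)
  qed
  have \<sigma>i: "?\<sigma> (nat \<bar>a\<bar>) = s" using a(2) im by (simp add: insert_letter_def)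
  have \<sigma>m: "?\<sigma> (nat \<bar>s\<bar>) = \<tau> i" using assms(3) by (simp add: insert_letter_def)
  have am: "\<bar>a\<bar> < int m" using small a(1) by blast
  have sB: "s \<notin> \<tau> ` B" using small(2)[of s] assms(3) by auto
  \<comment> \<open>\<open>c\<close> is the start of the new ascent: \<open>a\<close> rises to a
    positive \<open>s\<close>, and a negative \<open>s\<close> rises to
    \<open>\<tau> i\<close>.\<close>
  define c where "c = (if s > 0 then a else s)"
  have "exc_values (insert m B) ?\<sigma> = insert c (exc_values B \<tau> - {a})"
  proof (rule set_eqI)
    fix b
    consider "b = s" | "b = a" | "b \<noteq> s" "b \<noteq> a" by blast
    then show "b \<in> exc_values (insert m B) ?\<sigma> \<longleftrightarrow> b \<in> insert c (exc_values B \<tau> - {a})"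
    proof cases
      case 1
      have "b \<in> exc_values (insert m B) ?\<sigma> \<longleftrightarrow> s < \<tau> i"
        unfolding exc_values_def img using 1 \<sigma>m sB i by auto
      also have "\<dots> \<longleftrightarrow> c = s"
        using \<tau>i assms(3) am by (auto simp: c_def)
      finally show ?thesis using 1 sB by (auto simp: exc_values_def)
    next
      case 2
      have "b \<in> exc_values (insert m B) ?\<sigma> \<longleftrightarrow> a < s"
        unfolding exc_values_def img using 2 \<sigma>i sB a(1) by auto
      also have "\<dots> \<longleftrightarrow> c = a"
        using assms(3) am by (auto simp: c_def)
      finally show ?thesis using 2 by auto
    next
      case 3
      then have "b \<noteq> c" by (simp add: c_def)
      with 3 show ?thesis
        unfolding exc_values_def img using other[of b] by auto
    qed
  qed
  moreover have "c \<notin> exc_values B \<tau> - {a}"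
    using sB by (auto simp: c_def exc_values_def)
  ultimately show ?thesis
    using finite_exc_values[OF assms(1)] by simp
qed

text \<open>The new negative one-cycle counts as an ascent, and no other successor changes, because
  no value of \<open>\<tau>\<close> has absolute value \<open>m\<close>.\<close>

lemma exc_values_neg_one_cycle:
  assumes "finite B" "\<forall>b\<in>B. b < m" "m > 0" "\<tau> \<in> signed_perms_on B"
  shows "card (exc_values (insert m B) (\<tau>(m := - int m))) = Suc (card (exc_values B \<tau>))"
proof -
  let ?\<sigma> = "\<tau>(m := - int m)"
  have mB: "m \<notin> B" using assms(2) by auto
  have small: "nat \<bar>b\<bar> \<noteq> m" if "b \<in> \<tau> ` B" for b
    using signed_perms_on_abs_mem[OF assms(4)] mB that by auto
  have img: "?\<sigma> ` insert m B = insert (- int m) (\<tau> ` B)"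
    using mB by (auto simp: image_iff)
  have "exc_values (insert m B) ?\<sigma> = insert (- int m) (exc_values B \<tau>)"
    unfolding exc_values_def img using small assms(3) by auto
  moreover have "- int m \<notin> exc_values B \<tau>"
    using small[of "- int m"] by (auto simp: exc_values_def)
  ultimately show ?thesis
    using finite_exc_values[OF assms(1)] by simp
qed

lemma exc_values_pos_one_cycle:
  assumes "k \<in> B" "\<rho> \<in> signed_perms_on (B - {k})"
  shows "exc_values B (\<rho>(k := int k)) = exc_values (B - {k}) \<rho>"
proof -
  have small: "nat \<bar>b\<bar> \<noteq> k" if "b \<in> \<rho> ` (B - {k})" for b
    using signed_perms_on_abs_mem[OF assms(2)] that by auto
  have img: "(\<rho>(k := int k)) ` B = insert (int k) (\<rho> ` (B - {k}))"
    using assms(1) by (auto simp: image_iff)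
  show ?thesis
    unfolding exc_values_def img using small by auto
qed

section \<open>Adding and removing one-cycles\<close>

lemma signed_perms_on_insert_one_cycle:
  assumes "finite B" "m \<notin> B" "\<bar>s\<bar> = int m"
  shows "(\<lambda>\<tau>. \<tau>(m := s)) ` signed_perms_on B = {\<sigma> \<in> signed_perms_on (insert m B). \<sigma> m = s}"
    (is "?f ` _ = ?R")
proof (intro equalityI subsetI)
  have fin: "finite (insert m B)" using assms(1) by simp
  {
    fix \<sigma> assume "\<sigma> \<in> ?f ` signed_perms_on B"
    then obtain \<tau> where t: "\<tau> \<in> signed_perms_on B" "\<sigma> = \<tau>(m := s)" by blast
    have ne: "\<bar>\<tau> j\<bar> \<noteq> int m" if "j \<in> B" for j
      using signed_perms_on_abs_mem[OF t(1) that] assms(2) by auto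
    have "\<tau>(m := s) \<in> signed_perms_on (insert m B)"
    proof (rule signed_perms_onI[OF fin])
      fix j assume "j \<notin> insert m B"
      then show "(\<tau>(m := s)) j = undefined"
        using signed_perms_on_undefined[OF t(1)] by auto
    next
      fix j assume "j \<in> insert m B"
      then show "nat \<bar>(\<tau>(m := s)) j\<bar> \<in> insert m B"
        using assms(3) signed_perms_on_abs_mem[OF t(1)] by auto
    next
      fix j k assume "j \<in> insert m B" "k \<in> insert m B" "\<bar>(\<tau>(m := s)) j\<bar> = \<bar>(\<tau>(m := s)) k\<bar>"
      then show "j = k"
        using assms(3) ne ne[symmetric] signed_perms_on_inj[OF t(1)] by (auto split: if_splits)
    qed
    then show "\<sigma> \<in> ?R" using t(2) by simp
  next
    fix \<sigma> assume s: "\<sigma> \<in> ?R"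
    then have s': "\<sigma> \<in> signed_perms_on (insert m B)" by simp
    \<comment> \<open>The absolute value \<open>m\<close> is already used at position
      \<open>m\<close>, so the values on \<open>B\<close> stay within the letters of
      \<open>B\<close>.\<close>
    have ne: "\<bar>\<sigma> j\<bar> \<noteq> int m" if "j \<in> B" for j
      using signed_perms_on_inj[OF s', of j m] s that assms(2,3) by auto
    have mem: "nat \<bar>\<sigma> j\<bar> \<in> B" if "j \<in> B" for j
      using signed_perms_on_abs_mem[OF s', of j] ne[OF that] that by auto
    have "\<sigma>(m := undefined) \<in> signed_perms_on B"
    proof (rule signed_perms_onI[OF assms(1)])
      fix j assume "j \<notin> B"
      then show "(\<sigma>(m := undefined)) j = undefined"
        using signed_perms_on_undefined[OF s'] by auto
    next
      fix j assume "j \<in> B"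
      then show "nat \<bar>(\<sigma>(m := undefined)) j\<bar> \<in> B" using mem assms(2) by auto
    next
      fix j k assume "j \<in> B" "k \<in> B" "\<bar>(\<sigma>(m := undefined)) j\<bar> = \<bar>(\<sigma>(m := undefined)) k\<bar>"
      then show "j = k"
        using signed_perms_on_inj[OF s'] assms(2) by (auto split: if_splits)
    qed
    moreover have "\<sigma> = ?f (\<sigma>(m := undefined))" using s by auto
    ultimately show "\<sigma> \<in> ?f ` signed_perms_on B" by blast
  }
qed

lemma inj_on_insert_one_cycle:
  assumes "m \<notin> B"
  shows "inj_on (\<lambda>\<tau>. \<tau>(m := s)) (signed_perms_on B)"
proof (rule inj_onI)
  fix \<tau> \<tau>' assume t: "\<tau> \<in> signed_perms_on B" "\<tau>' \<in> signed_perms_on B" "\<tau>(m := s) = \<tau>'(m := s)"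
  \<comment> \<open>Both words are undefined outside \<open>B\<close>, so overwriting at
    \<open>m\<close> loses nothing.\<close>
  have "\<tau> m = \<tau>' m"
    using t(1,2) assms by (simp add: signed_perms_on_undefined)
  then show "\<tau> = \<tau>'" using t(3) by (metis fun_upd_triv fun_upd_upd)
qed

text \<open>These are the words into which insertion at \<open>i\<close> yields a derangement:
  position \<open>i\<close> receives the new letter with some sign, so a one-cycle there is
  broken.\<close>

definition derangements_except :: "nat \<Rightarrow> nat set \<Rightarrow> (nat \<Rightarrow> int) set" where
  "derangements_except i B = {\<tau> \<in> signed_perms_on B. \<forall>j\<in>B - {i}. \<tau> j \<noteq> int j}"

text \<open>Either the exempt position is not fixed, or it is a one-cycle whose removal leaves a
  derangement of the other letters.\<close>

lemma derangements_except_split: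
  assumes "finite B" "i \<in> B"
  shows "derangements_except i B = derangements_on B \<union> (\<lambda>\<rho>. \<rho>(i := int i)) ` derangements_on (B - {i})"
    and "derangements_on B \<inter> (\<lambda>\<rho>. \<rho>(i := int i)) ` derangements_on (B - {i}) = {}"
proof -
  have B: "insert i (B - {i}) = B" using assms(2) by auto
  have "(\<lambda>\<rho>. \<rho>(i := int i)) ` derangements_on (B - {i}) =
      {\<tau> \<in> signed_perms_on B. \<tau> i = int i \<and> (\<forall>j\<in>B - {i}. \<tau> j \<noteq> int j)}"
    (is "?f ` _ = ?R")
  proof (intro equalityI subsetI)
    fix \<tau> assume "\<tau> \<in> ?f ` derangements_on (B - {i})"
    then obtain \<rho> where r: "\<rho> \<in> derangements_on (B - {i})" "\<tau> = ?f \<rho>" by blast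
    have "?f \<rho> \<in> ?f ` signed_perms_on (B - {i})"
      using r(1) by (simp add: derangements_on_def)
    then have "\<tau> \<in> signed_perms_on B"
      using signed_perms_on_insert_one_cycle[of "B - {i}" i "int i"] assms(1) B r(2) by auto
    then show "\<tau> \<in> ?R" using r by (auto simp: derangements_on_def)
  next
    fix \<tau> assume t: "\<tau> \<in> ?R"
    then have "\<tau> \<in> ?f ` signed_perms_on (B - {i})"
      using signed_perms_on_insert_one_cycle[of "B - {i}" i "int i"] assms(1) B by auto
    then obtain \<rho> where r: "\<rho> \<in> signed_perms_on (B - {i})" "\<tau> = ?f \<rho>" by blast
    then have "\<rho> \<in> derangements_on (B - {i})"
      using t by (auto simp: derangements_on_def)
    then show "\<tau> \<in> ?f ` derangements_on (B - {i})" using r(2) by blast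
  qed
  then show "derangements_except i B = derangements_on B \<union> ?f ` derangements_on (B - {i})"
    and "derangements_on B \<inter> ?f ` derangements_on (B - {i}) = {}"
    using assms(2) by (auto simp: derangements_except_def derangements_on_def)
qed

section \<open>Decomposition of derangements by the largest letter\<close>

lemma sum_neg_one_cycle:
  assumes "finite B" "\<forall>b\<in>B. b < m" "m > 0"
  shows "(\<Sum>\<sigma> | \<sigma> \<in> derangements_on (insert m B) \<and> \<sigma> m = - int m. g \<sigma>) =
    (\<Sum>\<tau>\<in>derangements_on B. g (\<tau>(m := - int m)))"
proof -
  have mB: "m \<notin> B" using assms(2) by auto
  let ?f = "\<lambda>\<tau>. \<tau>(m := - int m)"
  have S: "?f ` signed_perms_on B = {\<sigma> \<in> signed_perms_on (insert m B). \<sigma> m = - int m}"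
    by (rule signed_perms_on_insert_one_cycle) (use assms(1) mB in auto)
  have "{\<sigma>. \<sigma> \<in> derangements_on (insert m B) \<and> \<sigma> m = - int m} = ?f ` derangements_on B"
    (is "?L = _")
  proof (intro equalityI subsetI)
    fix \<sigma> assume s: "\<sigma> \<in> ?L"
    then have "\<sigma> \<in> ?f ` signed_perms_on B"
      unfolding S by (simp add: derangements_on_def)
    then obtain \<tau> where t: "\<tau> \<in> signed_perms_on B" "\<sigma> = ?f \<tau>" by blast
    then have "\<tau> \<in> derangements_on B"
      using s mB by (auto simp: derangements_on_def split: if_splits)
    then show "\<sigma> \<in> ?f ` derangements_on B" using t(2) by blast
  next
    fix \<sigma> assume "\<sigma> \<in> ?f ` derangements_on B"
    then obtain \<tau> where t: "\<tau> \<in> derangements_on B" "\<sigma> = ?f \<tau>" by blast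
    then have "\<sigma> \<in> ?f ` signed_perms_on B" by (simp add: derangements_on_def)
    then have "\<sigma> \<in> signed_perms_on (insert m B)" unfolding S by simp
    then show "\<sigma> \<in> ?L"
      using t mB assms(3) by (auto simp: derangements_on_def)
  qed
  moreover have "inj_on ?f (derangements_on B)"
    using inj_on_insert_one_cycle[OF mB] by (rule inj_on_subset) (simp add: derangements_on_def)
  ultimately show ?thesis by (simp add: sum.reindex)
qed

text \<open>If a derangement does not have \<open>- int m\<close> as a one-cycle, then the letter
  \<open>m\<close> occurs, with some sign, at a unique position \<open>i\<close> in
  \<open>B\<close>. This position, the signed letter and the word with the letter cut out of its
  cycle determine the derangement.\<close>

lemma sum_insert_letter:
  assumes "finite B" "\<forall>b\<in>B. b < m" "m > 0"
  shows "(\<Sum>\<sigma> | \<sigma> \<in> derangements_on (insert m B) \<and> \<sigma> m \<noteq> - int m. g \<sigma>) =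
    (\<Sum>i\<in>B. \<Sum>s\<in>{int m, - int m}. \<Sum>\<tau>\<in>derangements_except i B. g (insert_letter m s i \<tau>))"
proof -
  have mB: "m \<notin> B" using assms(2) by auto
  let ?T = "SIGMA i:B. {int m, - int m} \<times> derangements_except i B"
  let ?S = "{\<sigma>. \<sigma> \<in> derangements_on (insert m B) \<and> \<sigma> m \<noteq> - int m}"
  define p where "p \<sigma> = (SOME i. i \<in> B \<and> \<bar>\<sigma> i\<bar> = int m)" for \<sigma> :: "nat \<Rightarrow> int"
  have p: "p \<sigma> \<in> B" "\<bar>\<sigma> (p \<sigma>)\<bar> = int m" if "\<sigma> \<in> ?S" for \<sigma>
  proof -
    have s: "\<sigma> \<in> signed_perms_on (insert m B)" "\<sigma> m \<noteq> int m" "\<sigma> m \<noteq> - int m"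
      using that by (auto simp: derangements_on_def)
    obtain i where i: "i \<in> insert m B" "nat \<bar>\<sigma> i\<bar> = m"
      using signed_perms_on_surj[OF s(1)] by blast
    have "i \<noteq> m"
    proof
      assume "i = m"
      then have "\<bar>\<sigma> m\<bar> = int m" using i(2) by simp
      then show False using s(2,3) by linarith
    qed
    then have "i \<in> B \<and> \<bar>\<sigma> i\<bar> = int m" using i by auto
    then have "p \<sigma> \<in> B \<and> \<bar>\<sigma> (p \<sigma>)\<bar> = int m" unfolding p_def by (rule someI)
    then show "p \<sigma> \<in> B" "\<bar>\<sigma> (p \<sigma>)\<bar> = int m" by auto
  qed
  have pI: "p \<sigma> = i" if "\<sigma> \<in> ?S" "i \<in> B" "\<bar>\<sigma> i\<bar> = int m" for \<sigma> i
    using signed_perms_on_inj[of \<sigma> "insert m B" "p \<sigma>" i] p[OF that(1)] that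
    by (auto simp: derangements_on_def)
  have ins: "insert_letter m s i \<tau> \<in> ?S"
    if h: "i \<in> B" "s \<in> {int m, - int m}" "\<tau> \<in> derangements_except i B" for i s \<tau>
  proof -
    have t: "\<tau> \<in> signed_perms_on B" "\<forall>j\<in>B - {i}. \<tau> j \<noteq> int j"
      using h(3) by (auto simp: derangements_except_def)
    \<comment> \<open>Position \<open>m\<close> receives \<open>\<tau> i\<close>, so this bound
      keeps \<open>m\<close> from becoming a one-cycle of either sign.\<close>
    have "\<bar>\<tau> i\<bar> < int m" using signed_perms_on_abs_mem[OF t(1) h(1)] assms(2) by auto
    moreover have "insert_letter m s i \<tau> \<in> signed_perms_on (insert m B)"
      by (rule insert_letter_signed_perms_on) (use assms(1) mB h t in auto)
    moreover have "i < m" using h(1) assms(2) by auto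
    ultimately show ?thesis
      using h t by (auto simp: derangements_on_def insert_letter_def)
  qed
  have "(\<Sum>\<sigma>\<in>?S. g \<sigma>) = (\<Sum>(i, s, \<tau>)\<in>?T. g (insert_letter m s i \<tau>))"
  proof (rule sum.reindex_bij_witness
      [where j = "\<lambda>\<sigma>. (p \<sigma>, \<sigma> (p \<sigma>), \<sigma>(p \<sigma> := \<sigma> m, m := undefined))"
         and i = "\<lambda>(i, s, \<tau>). insert_letter m s i \<tau>"])
    fix \<sigma> assume s: "\<sigma> \<in> ?S"
    note ps = p[OF s]
    have pm: "p \<sigma> \<noteq> m" using ps(1) mB by auto
    show eq: "(case (p \<sigma>, \<sigma> (p \<sigma>), \<sigma>(p \<sigma> := \<sigma> m, m := undefined)) of
        (i, s, \<tau>) \<Rightarrow> insert_letter m s i \<tau>) = \<sigma>"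
      using pm by (auto simp: insert_letter_def)
    show "(case (p \<sigma>, \<sigma> (p \<sigma>), \<sigma>(p \<sigma> := \<sigma> m, m := undefined)) of
        (i, s, \<tau>) \<Rightarrow> g (insert_letter m s i \<tau>)) = g \<sigma>"
      using eq by simp
    have "\<sigma>(p \<sigma> := \<sigma> m, m := undefined) \<in> signed_perms_on B"
      by (rule remove_letter_signed_perms_on)
         (use assms(1) mB ps s in \<open>auto simp: derangements_on_def\<close>)
    \<comment> \<open>The exemption is needed here: position \<open>p \<sigma>\<close> receives
      \<open>\<sigma> m\<close>, which may equal \<open>int (p \<sigma>)\<close>.\<close>
    then have "\<sigma>(p \<sigma> := \<sigma> m, m := undefined) \<in> derangements_except (p \<sigma>) B"
      using s mB by (auto simp: derangements_except_def derangements_on_def)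
    then show "(p \<sigma>, \<sigma> (p \<sigma>), \<sigma>(p \<sigma> := \<sigma> m, m := undefined)) \<in> ?T"
      using ps by auto
  next
    fix x assume "x \<in> ?T"
    then obtain i s \<tau> where x: "x = (i, s, \<tau>)" "i \<in> B" "s \<in> {int m, - int m}"
      "\<tau> \<in> derangements_except i B" by auto
    let ?\<sigma> = "insert_letter m s i \<tau>"
    have S: "?\<sigma> \<in> ?S" using ins x by blast
    then show "(case x of (i, s, \<tau>) \<Rightarrow> insert_letter m s i \<tau>) \<in> ?S" using x(1) by simp
    have im: "i \<noteq> m" using x(2) mB by auto
    have \<sigma>i: "?\<sigma> i = s" using im by (simp add: insert_letter_def)
    have "p ?\<sigma> = i" using pI[OF S x(2)] x(3) \<sigma>i by auto
    \<comment> \<open>By extensionality, resetting position \<open>m\<close> restores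
      \<open>\<tau>\<close> exactly.\<close>
    moreover have "\<tau> m = undefined"
      using x(4) mB by (auto simp: derangements_except_def signed_perms_on_def PiE_iff extensional_def)
    then have "?\<sigma>(i := ?\<sigma> m, m := undefined) = \<tau>"
      using im by (auto simp: insert_letter_def)
    ultimately show "(\<lambda>\<sigma>. (p \<sigma>, \<sigma> (p \<sigma>), \<sigma>(p \<sigma> := \<sigma> m, m := undefined)))
        (case x of (i, s, \<tau>) \<Rightarrow> insert_letter m s i \<tau>) = x"
      using x(1) \<sigma>i by simp
  qed
  also have "\<dots> = (\<Sum>i\<in>B. \<Sum>s\<in>{int m, - int m}. \<Sum>\<tau>\<in>derangements_except i B.
      g (insert_letter m s i \<tau>))"
    unfolding sum.cartesian_product
    by (rule sum.Sigma[symmetric])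
       (use assms(1) finite_signed_perms_on[OF assms(1)] in \<open>auto simp: derangements_except_def\<close>)
  finally show ?thesis .
qed

subsection \<open>The recurrence\<close>

text \<open>Insertion after one of the \<open>e\<close> excedance values replaces that ascent by
  another and keeps the count; after any other value the count grows by one. The sign of
  \<open>s\<close> does not affect the result.\<close>

lemma sum_insertions_into_derangement:
  assumes "finite B" "\<forall>b\<in>B. b < m" "\<bar>s\<bar> = int m" "\<tau> \<in> signed_perms_on B"
  defines "e \<equiv> card (exc_values B \<tau>)"
  shows "(\<Sum>i\<in>B. monom (1::int) (card (exc_values (insert m B) (insert_letter m s i \<tau>)))) =
    of_nat e * monom 1 e + of_nat (card B - e) * monom 1 (Suc e)"
proof -
  let ?E = "exc_values B \<tau>"
  have E: "?E \<subseteq> \<tau> ` B" "finite ?E"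
    using finite_exc_values[OF assms(1)] by (auto simp: exc_values_def)
  have cardV: "card (\<tau> ` B) = card B"
    using bij_betw_abs_values[OF assms(4)] by (rule bij_betw_same_card)
  have "(\<Sum>i\<in>B. monom (1::int) (card (exc_values (insert m B) (insert_letter m s i \<tau>)))) =
      (\<Sum>a\<in>\<tau> ` B. monom 1 (card (exc_values (insert m B) (insert_letter m s (nat \<bar>a\<bar>) \<tau>))))"
    by (rule sum.reindex_bij_betw[OF bij_betw_abs_values[OF assms(4)], symmetric])
  also have "\<dots> = (\<Sum>a\<in>\<tau> ` B. monom 1 (Suc (card (?E - {a}))))"
    by (intro sum.cong refl arg_cong2[where f = monom] exc_values_insert_letter) (use assms in auto)
  also have "\<dots> = (\<Sum>a\<in>?E. monom 1 (Suc (card (?E - {a})))) +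
      (\<Sum>a\<in>\<tau> ` B - ?E. monom 1 (Suc (card (?E - {a}))))"
    by (rule trans[OF sum.subset_diff[OF E(1) finite_imageI[OF assms(1)]] add.commute])
  also have "(\<Sum>a\<in>?E. monom (1::int) (Suc (card (?E - {a})))) = (\<Sum>a\<in>?E. monom 1 e)"
    unfolding e_def using E(2) by (intro sum.cong refl) (simp only: card_Suc_Diff1)
  also have "(\<Sum>a\<in>\<tau> ` B - ?E. monom (1::int) (Suc (card (?E - {a})))) =
      (\<Sum>a\<in>\<tau> ` B - ?E. monom 1 (Suc e))"
    unfolding e_def by (intro sum.cong refl) simp
  finally show ?thesis
    using E by (simp add: e_def card_Diff_subset cardV)
qed

text \<open>The left side is the total contribution of one derangement with \<open>e\<close>
  excedances: insertions with two signs and one new negative one-cycle. The operator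
  \<open>q * pderiv\<close> multiplies \<open>monom 1 e\<close> by \<open>e\<close>, which turns the
  factors \<open>e\<close> into a derivative.\<close>

lemma weight_identity:
  fixes q :: "int poly"
  assumes "q = monom 1 1" "e \<le> b"
  shows "2 * (of_nat e * monom 1 e + of_nat (b - e) * monom 1 (Suc e)) + monom 1 (Suc e) =
    of_nat (2 * b + 1) * q * monom 1 e + 2 * q * (1 - q) * pderiv (monom 1 e)"
proof -
  have m: "monom 1 (Suc e) = q * monom 1 e" by (simp add: assms(1) mult_monom)
  have d: "q * pderiv (monom 1 e) = of_nat e * monom 1 e"
    by (cases e) (simp_all add: assms(1) pderiv_monom mult_monom of_nat_poly smult_monom del: of_nat_Suc)
  have "2 * q * (1 - q) * pderiv (monom 1 e) = 2 * (1 - q) * (of_nat e * monom 1 e)"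
    unfolding d[symmetric] by (simp add: algebra_simps)
  then show ?thesis
    using assms(2) by (simp add: m of_nat_diff algebra_simps)
qed

text \<open>The first two terms collect what arises from derangements of \<open>B\<close>. The last
  comes from insertion into a positive one-cycle \<open>k\<close>, whose removal leaves a
  derangement of \<open>B - {k}\<close>: the factor 2 counts signs and \<open>q\<close> marks the
  ascent created.\<close>

lemma derangement_poly_insert:
  fixes q :: "int poly"
  assumes "finite B" "\<forall>b\<in>B. b < m" "m > 0" "q = monom 1 1"
  shows "derangement_poly (insert m B) =
    of_nat (2 * card B + 1) * q * derangement_poly B
    + 2 * q * (1 - q) * pderiv (derangement_poly B)
    + 2 * q * (\<Sum>k\<in>B. derangement_poly (B - {k}))"
proof -
  let ?A = "insert m B"
  define w :: "(nat \<Rightarrow> int) \<Rightarrow> int poly" where "w \<sigma> = monom 1 (card (exc_values ?A \<sigma>))" for \<sigma>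
  define e where "e \<tau> = card (exc_values B \<tau>)" for \<tau>
  let ?ins = "\<lambda>\<tau>. of_nat (e \<tau>) * monom 1 (e \<tau>) + of_nat (card B - e \<tau>) * monom 1 (Suc (e \<tau>)) :: int poly"
  have DS: "\<tau> \<in> signed_perms_on C" if "\<tau> \<in> derangements_on C" for \<tau> C
    using that by (simp add: derangements_on_def)
  have q_monom: "q * monom 1 k = monom 1 (Suc k)" for k
    by (simp add: assms(4) mult_monom)
  have fix_part: "(\<Sum>\<tau>\<in>(\<lambda>\<rho>. \<rho>(i := int i)) ` derangements_on (B - {i}). w (insert_letter m s i \<tau>)) =
      q * derangement_poly (B - {i})" if i: "i \<in> B" and s: "\<bar>s\<bar> = int m" for i s
  proof -
    have inj: "inj_on (\<lambda>\<rho>. \<rho>(i := int i)) (derangements_on (B - {i}))"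
      using inj_on_insert_one_cycle[of i "B - {i}"]
      by (rule inj_on_subset) (auto simp: derangements_on_def)
    have "w (insert_letter m s i (\<rho>(i := int i))) = q * monom 1 (card (exc_values (B - {i}) \<rho>))"
      if r: "\<rho> \<in> derangements_on (B - {i})" for \<rho>
    proof -
      have B: "insert i (B - {i}) = B" using i by auto
      have "\<rho>(i := int i) \<in> (\<lambda>\<rho>. \<rho>(i := int i)) ` signed_perms_on (B - {i})"
        using DS[OF r] by simp
      then have t: "\<rho>(i := int i) \<in> signed_perms_on B"
        using signed_perms_on_insert_one_cycle[of "B - {i}" i "int i"] assms(1) B by auto
      have "int i \<in> (\<rho>(i := int i)) ` B" using i by force
      then have "card (exc_values ?A (insert_letter m s i (\<rho>(i := int i)))) =
          Suc (card (exc_values B (\<rho>(i := int i)) - {int i}))"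
        by (rule exc_values_insert_letter[OF assms(1,2) s t]) simp
      \<comment> \<open>A nonnegative one-cycle is never an excedance, so the new ascent is a pure
        gain.\<close>
      moreover have "exc_values B (\<rho>(i := int i)) - {int i} = exc_values B (\<rho>(i := int i))"
        by (auto simp: exc_values_def)
      ultimately show ?thesis
        by (simp only: w_def q_monom exc_values_pos_one_cycle[OF i DS[OF r]])
    qed
    then show ?thesis
      by (simp add: sum.reindex[OF inj] derangement_poly_def sum_distrib_left)
  qed
  have ex: "(\<Sum>\<tau>\<in>derangements_except i B. w (insert_letter m s i \<tau>)) =
      (\<Sum>\<tau>\<in>derangements_on B. w (insert_letter m s i \<tau>)) + q * derangement_poly (B - {i})"
    if i: "i \<in> B" and s: "\<bar>s\<bar> = int m" for i s
    unfolding derangements_except_split(1)[OF assms(1) i]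
    by (subst sum.union_disjoint)
       (use assms(1) derangements_except_split(2)[OF assms(1) i] fix_part[OF i s]
         in \<open>auto simp: finite_derangements_on\<close>)
  have per_sign: "(\<Sum>i\<in>B. \<Sum>\<tau>\<in>derangements_except i B. w (insert_letter m s i \<tau>)) =
      (\<Sum>\<tau>\<in>derangements_on B. ?ins \<tau>) + q * (\<Sum>k\<in>B. derangement_poly (B - {k}))"
    if s: "\<bar>s\<bar> = int m" for s
  proof -
    have "(\<Sum>i\<in>B. \<Sum>\<tau>\<in>derangements_on B. w (insert_letter m s i \<tau>)) =
        (\<Sum>\<tau>\<in>derangements_on B. \<Sum>i\<in>B. w (insert_letter m s i \<tau>))"
      by (rule sum.swap)
    also have "\<dots> = (\<Sum>\<tau>\<in>derangements_on B. ?ins \<tau>)"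
      unfolding w_def e_def
      by (intro sum.cong refl sum_insertions_into_derangement) (use assms s DS in auto)
    finally show ?thesis
      using s by (simp add: ex sum.distrib sum_distrib_left)
  qed
  \<comment> \<open>The split is by whether the largest letter forms a negative one-cycle.\<close>
  have "derangement_poly ?A =
      (\<Sum>\<sigma> | \<sigma> \<in> derangements_on ?A \<and> \<sigma> m = - int m. w \<sigma>) +
      (\<Sum>\<sigma> | \<sigma> \<in> derangements_on ?A \<and> \<sigma> m \<noteq> - int m. w \<sigma>)"
    unfolding derangement_poly_def w_def
    using sum.Int_Diff[of "derangements_on ?A" _ "{\<sigma>. \<sigma> m = - int m}"]
      finite_derangements_on[of ?A] assms(1)
    by (simp add: Int_def set_diff_eq)
  also have "(\<Sum>\<sigma> | \<sigma> \<in> derangements_on ?A \<and> \<sigma> m = - int m. w \<sigma>) =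
      (\<Sum>\<tau>\<in>derangements_on B. monom 1 (Suc (e \<tau>)))"
    unfolding sum_neg_one_cycle[OF assms(1-3)] w_def e_def
    by (intro sum.cong refl arg_cong2[where f = monom] exc_values_neg_one_cycle) (use assms DS in auto)
  \<comment> \<open>Both signs give the same sum, and they are distinct since \<open>m > 0\<close>;
    hence the factor 2.\<close>
  also have "(\<Sum>\<sigma> | \<sigma> \<in> derangements_on ?A \<and> \<sigma> m \<noteq> - int m. w \<sigma>) =
      2 * ((\<Sum>\<tau>\<in>derangements_on B. ?ins \<tau>) + q * (\<Sum>k\<in>B. derangement_poly (B - {k})))"
    unfolding sum_insert_letter[OF assms(1-3)]
    using assms(3) by (simp add: sum.distrib per_sign)
  also have "(\<Sum>\<tau>\<in>derangements_on B. monom 1 (Suc (e \<tau>))) +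
      2 * ((\<Sum>\<tau>\<in>derangements_on B. ?ins \<tau>) + q * (\<Sum>k\<in>B. derangement_poly (B - {k}))) =
      (\<Sum>\<tau>\<in>derangements_on B. 2 * ?ins \<tau> + monom 1 (Suc (e \<tau>))) +
      2 * q * (\<Sum>k\<in>B. derangement_poly (B - {k}))"
    unfolding sum.distrib sum_distrib_left[symmetric] by (simp add: algebra_simps)
  also have "(\<Sum>\<tau>\<in>derangements_on B. 2 * ?ins \<tau> + monom 1 (Suc (e \<tau>))) =
      (\<Sum>\<tau>\<in>derangements_on B. of_nat (2 * card B + 1) * q * monom 1 (e \<tau>) +
        2 * q * (1 - q) * pderiv (monom 1 (e \<tau>)))"
    by (intro sum.cong refl weight_identity)
       (use assms card_exc_values_le DS in \<open>auto simp: e_def\<close>)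
  also have "\<dots> = of_nat (2 * card B + 1) * q * derangement_poly B
      + 2 * q * (1 - q) * pderiv (derangement_poly B)"
    unfolding derangement_poly_def e_def sum.distrib sum_distrib_left[symmetric]
    \<comment> \<open>The first-order case of the rule for higher derivatives moves
      \<open>pderiv\<close> across the sum.\<close>
    by (simp add: higher_pderiv_sum[of 1, simplified])
  finally show ?thesis .
qed

section \<open>Independence of the choice of letters\<close>

text \<open>Strong induction is used because the recurrence refers to sets with one and with two
  letters fewer. The letter 0 is excluded because it carries no sign, whereas the recurrence counts
  two signs for the largest letter.\<close>

lemma derangement_poly_cong_card:
  assumes "finite A" "finite A'" "0 \<notin> A" "0 \<notin> A'" "card A = card A'"
  shows "derangement_poly A = derangement_poly A'"
  using assms
proof (induction "card A" arbitrary: A A' rule: less_induct)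
  case less
  show ?case
  proof (cases "A = {}")
    case True
    then show ?thesis using less.prems by auto
  next
    case False
    then have ne': "A' \<noteq> {}" using less.prems by auto
    define q :: "int poly" where "q = monom 1 1"
    have rec: "derangement_poly C =
        of_nat (2 * card (C - {Max C}) + 1) * q * derangement_poly (C - {Max C})
        + 2 * q * (1 - q) * pderiv (derangement_poly (C - {Max C}))
        + 2 * q * (\<Sum>k\<in>C - {Max C}. derangement_poly (C - {Max C} - {k}))"
      if "finite C" "C \<noteq> {}" "0 \<notin> C" for C
    proof -
      have m: "Max C \<in> C" using that by simp
      then have "Max C > 0" using that(3) by (metis neq0_conv)
      moreover have "\<forall>b\<in>C - {Max C}. b < Max C"
        using that(1) by (auto simp: less_le)
      moreover have "insert (Max C) (C - {Max C}) = C" using m by auto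
      ultimately show ?thesis
        using derangement_poly_insert[of "C - {Max C}" "Max C" q] that(1) by (simp add: q_def)
    qed
    let ?B = "A - {Max A}" and ?B' = "A' - {Max A'}"
    have MA: "Max A \<in> A" "Max A' \<in> A'" using False ne' less.prems by auto
    have cB: "card ?B = card A - 1" "card ?B' = card A - 1" and pos: "card A > 0"
      using MA less.prems False by (auto simp: card_gt_0_iff)
    have B: "derangement_poly ?B = derangement_poly ?B'"
      by (rule less.hyps) (use cB pos less.prems in auto)
    have eq: "derangement_poly (?B - {k}) = derangement_poly (?B' - {k'})"
      if "k \<in> ?B" "k' \<in> ?B'" for k k'
      by (rule less.hyps) (use cB pos less.prems that card_Diff_singleton[OF that(1)]
         card_Diff_singleton[OF that(2)] in auto)
    \<comment> \<open>Any bijection serves, because \<open>eq\<close> holds for all pairs; it only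
      matches the numbers of summands.\<close>
    obtain h where h: "bij_betw h ?B ?B'"
      using finite_same_card_bij[of ?B ?B'] less.prems cB by auto
    have "(\<Sum>k\<in>?B. derangement_poly (?B - {k})) = (\<Sum>k\<in>?B. derangement_poly (?B' - {h k}))"
      using h by (intro sum.cong refl eq) (auto simp: bij_betw_def)
    also have "\<dots> = (\<Sum>k\<in>?B'. derangement_poly (?B' - {k}))"
      by (rule sum.reindex_bij_betw[OF h])
    finally have S: "(\<Sum>k\<in>?B. derangement_poly (?B - {k})) = (\<Sum>k\<in>?B'. derangement_poly (?B' - {k}))" .
    show ?thesis
      unfolding rec[OF less.prems(1) False less.prems(3)] rec[OF less.prems(2) ne' less.prems(4)]
        B S cB ..
  qed
qed

theorem theorem4p2:
  fixes n :: nat and q :: "int poly"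
  assumes "n \<ge> 2"
    and "q = monom 1 1"
  shows "dB n = of_int (2 * int n - 1) * q * dB (n - 1)
               + 2 * q * (1 - q) * pderiv (dB (n - 1))
               + of_int (2 * (int n - 1)) * q * dB (n - 2)"
proof -
  let ?B = "{1..n - 1}"
  have n: "{1..n} = insert n ?B" using assms(1) by auto
  \<comment> \<open>Removing \<open>k\<close> leaves a set with a gap but \<open>n - 2\<close>
    letters, so all \<open>n - 1\<close> summands agree; this produces the coefficient
    \<open>2 * (n - 1)\<close>.\<close>
  have "derangement_poly (?B - {k}) = dB (n - 2)" if "k \<in> ?B" for k
    unfolding dB_eq by (rule derangement_poly_cong_card) (use that in auto)
  then have "(\<Sum>k\<in>?B. derangement_poly (?B - {k})) = of_nat (n - 1) * dB (n - 2)"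
    by simp
  then have "dB n = of_nat (2 * (n - 1) + 1) * q * dB (n - 1)
      + 2 * q * (1 - q) * pderiv (dB (n - 1)) + 2 * q * (of_nat (n - 1) * dB (n - 2))"
    unfolding dB_eq[of n] dB_eq[of "n - 1"] n
    by (subst derangement_poly_insert[where q = q]) (use assms in \<open>auto simp del: of_nat_add of_nat_mult\<close>)
  \<comment> \<open>Here \<open>2 * (n - 1) + 1\<close> becomes \<open>2 * n - 1\<close>; as
    \<open>n \<ge> 2\<close>, the truncated subtraction is exact.\<close>
  then show ?thesis
    using assms(1) by (simp add: of_nat_diff algebra_simps)
qed

end
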